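(* Let $\mathbb{F}$ be a field, let $n\ge 2$ and $k\ge 1$ be integers, and let $A\in \mathbb{M}_{n}(\mathbb{F})$ be a nonzero matrix. Then there exist an invertible matrix $U\in \mathbb{M}_{n}(\mathbb{F})$ and a nilpotent matrix $N\in \mathbb{M}_{n}(\mathbb{F})$ with $N^k=0$ such that $A=U+N$ if, and only if, the rank of $A$ is greater than or equal to $\frac{n}{k}$.
   Context: $\mathbb{M}_n(\mathbb{F})$ denotes the ring of $n\times n$ matrices over $\mathbb{F}$. The inequality $\operatorname{rank}(A)\ge \frac{n}{k}$ is an inequality of rational numbers ($\frac nk$ need not be an integer). *)

theory Defs
  imports "Jordan_Normal_Form.DL_Rank" "HOL.Rat"
begin

definition nilpotent_mat :: "'a :: semiring_1 mat \<Rightarrow> bool" where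
  "nilpotent_mat A \<longleftrightarrow>
     square_mat A \<and> (\<exists>m\<ge>1. A ^\<^sub>m m = 0\<^sub>m (dim_row A) (dim_row A))"

end

theory Submission
  imports Defs "Jordan_Normal_Form.Jordan_Normal_Form" "Jordan_Normal_Form.Matrix_Kernel"
begin

text \<open>
  If \<open>A = U + N\<close>, then \<open>U N\<^sup>j = A N\<^sup>j - N\<^bsup>j+1\<^esup>\<close>, so the rank drops by at most \<open>rank A\<close> from \<open>N\<^sup>j\<close>
  to \<open>N\<^bsup>j+1\<^esup>\<close>. It starts at \<open>n\<close>, and \<open>N\<^sup>k = 0\<close> forces \<open>n \<le> k rank A\<close>.

  Conversely, \<open>A - N\<close> is invertible once the ranges of \<open>A\<close> and \<open>N\<close> meet trivially and so do the
  kernels. For a basis \<open>x\<^sub>1, \<dots>, x\<^sub>n\<close> and \<open>r = rank A\<close>, let \<open>N\<close> send \<open>x\<^sub>j\<close> to \<open>x\<^bsub>j-r\<^esub>\<close>, or to \<open>0\<close> if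
  \<open>j \<le> r\<close>; its \<open>k\<close>-th power vanishes if \<open>n \<le> k r\<close>, its kernel is spanned by the first \<open>r\<close> vectors
  and its range by the first \<open>n - r\<close>. These have to span complements of the kernel and the range
  of \<open>A\<close>. Such a basis is chosen vector by vector, as each vector only has to avoid two proper
  subspaces, whose union is never the whole space.
\<close>

lemma (in vectorspace) not_in_two_spansE:
  assumes "S \<subseteq> carrier V" "span S \<noteq> carrier V" and "T \<subseteq> carrier V" "span T \<noteq> carrier V"
  obtains v where "v \<in> carrier V" "v \<notin> span S" "v \<notin> span T"
proof -
  obtain s where s: "s \<in> carrier V" "s \<notin> span S" using assms(1,2) span_is_subset2 by blast
  obtain t where t: "t \<in> carrier V" "t \<notin> span T" using assms(3,4) span_is_subset2 by blast
  consider "s \<notin> span T" | "t \<notin> span S" | "s \<in> span T" "t \<in> span S" by blast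
  then show ?thesis
  proof cases
    case 3
    have "t \<oplus>\<^bsub>V\<^esub> s \<notin> span S" using span_add[OF assms(1) 3(2) s(1)] s(2) by blast
    moreover have "s \<oplus>\<^bsub>V\<^esub> t \<notin> span T" using span_add[OF assms(3) 3(1) t(1)] t(2) by blast
    ultimately show ?thesis using that[of "s \<oplus>\<^bsub>V\<^esub> t"] s t by (simp add: M.a_comm)
  qed (use s t that in blast)+
qed

lemma (in vectorspace) span_Int_eq_zero:
  assumes carrier: "S \<subseteq> carrier V" "T \<subseteq> carrier V"
    and indpt: "lin_indpt (S \<union> T)" and disjoint: "S \<inter> T = {}"
  shows "span S \<inter> span T = {\<zero>\<^bsub>V\<^esub>}"
proof (intro equalityI subsetI)
  fix v assume v: "v \<in> span S \<inter> span T"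
  then have "\<ominus>\<^bsub>V\<^esub> v \<in> span T" using span_neg[OF carrier(2)] by blast
  then obtain b B where B: "finite B" "B \<subseteq> T" "b \<in> B \<rightarrow> carrier K" "\<ominus>\<^bsub>V\<^esub> v = lincomb b B"
    unfolding span_def by auto
  obtain a A where A: "finite A" "A \<subseteq> S" "a \<in> A \<rightarrow> carrier K" "v = lincomb a A"
    using v unfolding span_def by auto
  define c where "c = (\<lambda>u. if u \<in> A then a u else b u)"
  have "v \<in> carrier V" using v carrier by auto
  then have "\<zero>\<^bsub>V\<^esub> = lincomb a A \<oplus>\<^bsub>V\<^esub> lincomb b B" by (simp add: M.r_neg flip: A(4) B(4))
  also have "\<dots> = lincomb c (A \<union> B)"
    unfolding c_def using A B carrier disjoint by (intro lincomb_union2) auto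
  finally have "c \<in> A \<union> B \<rightarrow> {\<zero>\<^bsub>K\<^esub>}"
    using A B by (intro not_lindepD[OF indpt]) (auto simp: c_def)
  then have "a \<in> A \<rightarrow> {\<zero>\<^bsub>K\<^esub>}" by (auto simp: c_def Pi_iff ball_Un)
  then have "lincomb a A = \<zero>\<^bsub>V\<^esub>" using A carrier by (intro lincomb_zero) auto
  then show "v \<in> {\<zero>\<^bsub>V\<^esub>}" using A by simp
qed (auto simp: span_zero)

definition (in vectorspace) lin_indpt_over :: "'c set \<Rightarrow> 'c list \<Rightarrow> bool" where
  "lin_indpt_over S xs \<longleftrightarrow>
     set xs \<subseteq> carrier V \<and> distinct xs \<and> S \<inter> set xs = {} \<and> lin_indpt (S \<union> set xs)"

lemma (in vectorspace) lin_indpt_over_snoc: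
  assumes "S \<subseteq> carrier V" and xs: "lin_indpt_over S xs"
    and v: "v \<in> carrier V" "v \<notin> span (S \<union> set xs)"
  shows "lin_indpt_over S (xs @ [v])"
proof -
  have carrier: "S \<union> set xs \<subseteq> carrier V" using assms unfolding lin_indpt_over_def by auto
  then have "v \<notin> S \<union> set xs" using span_mem[OF carrier] v(2) by blast
  then show ?thesis
    using lin_dep_iff_in_span[OF carrier _ v(1)] v xs unfolding lin_indpt_over_def by auto
qed

text \<open>
  Every prefix of \<open>xs\<close> then spans a subspace transversal to \<open>span S\<close>: a shorter prefix is part of
  the one singled out here, which spans a complement, and a longer one contains it.
\<close>
definition (in vectorspace) general_position :: "'c set \<Rightarrow> 'c list \<Rightarrow> bool" where
  "general_position S xs \<longleftrightarrow>
     lin_indpt_over {} xs \<and> lin_indpt_over S (take (dim - card S) xs)"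

lemma (in vectorspace) general_position_span_Int:
  assumes "S \<subseteq> carrier V" "general_position S xs"
  shows "span S \<inter> span (set (take (dim - card S) xs)) = {\<zero>\<^bsub>V\<^esub>}"
  using assms by (intro span_Int_eq_zero) (auto simp: general_position_def lin_indpt_over_def)

lemma (in vectorspace) general_position_snocE:
  assumes S: "S \<subseteq> carrier V" "finite S"
    and xs: "general_position S xs" "length xs < dim"
  obtains Y where "Y \<subseteq> carrier V" "span Y \<noteq> carrier V"
    "\<And>v. v \<in> carrier V \<Longrightarrow> v \<notin> span Y \<Longrightarrow> general_position S (xs @ [v])"
proof
  define Y where "Y = (if length xs < dim - card S then S \<union> set xs else set xs)"
  have indpt: "lin_indpt_over {} xs" "lin_indpt_over S (take (dim - card S) xs)"
    using xs(1) by (auto simp: general_position_def)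
  then have "set xs \<subseteq> carrier V" "card (set xs) = length xs"
    by (auto simp: lin_indpt_over_def distinct_card)
  then show carrier: "Y \<subseteq> carrier V" using S by (simp add: Y_def)
  have "card Y < dim"
    using card_Un_le[of S "set xs"] \<open>card (set xs) = length xs\<close> xs(2) by (auto simp: Y_def)
  then show "span Y \<noteq> carrier V"
    using gen_ge_dim[OF _ carrier] S(2) by (auto simp: Y_def split: if_splits)
  fix v assume v: "v \<in> carrier V" "v \<notin> span Y"
  have "span (set xs) \<subseteq> span Y" by (intro span_is_monotone) (simp add: Y_def)
  then have "lin_indpt_over {} (xs @ [v])"
    using indpt(1) v by (intro lin_indpt_over_snoc) auto
  moreover have "lin_indpt_over S (take (dim - card S) (xs @ [v]))"
  proof (cases "length xs < dim - card S")
    case True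
    then have "lin_indpt_over S (xs @ [v])"
      using indpt(2) S v by (intro lin_indpt_over_snoc) (simp_all add: Y_def)
    then show ?thesis using True by simp
  qed (use indpt(2) in simp)
  ultimately show "general_position S (xs @ [v])" by (simp add: general_position_def)
qed

lemma (in vectorspace) basis_in_general_position:
  assumes fin_dim: "fin_dim"
    and S: "S \<subseteq> carrier V" "lin_indpt S" and T: "T \<subseteq> carrier V" "lin_indpt T"
  obtains xs where "basis (set xs)" "distinct xs" "length xs = dim"
    "general_position S xs" "general_position T xs"
proof -
  have fin: "finite S" "finite T" using S T li_le_dim(1)[OF fin_dim] by auto
  have "\<exists>xs. length xs = m \<and> general_position S xs \<and> general_position T xs" if "m \<le> dim" for m
    using that
  proof (induction m)
    case 0
    have "lin_indpt {}" using subset_li_is_li[OF S(2)] by simp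
    then show ?case
      using S T by (intro exI[of _ "[]"]) (auto simp: general_position_def lin_indpt_over_def)
  next
    case (Suc m)
    then obtain xs where xs: "length xs = m" "general_position S xs" "general_position T xs" by auto
    then have "length xs < dim" using Suc.prems by simp
    then obtain Y Z where Y: "Y \<subseteq> carrier V" "span Y \<noteq> carrier V"
        "\<And>v. v \<in> carrier V \<Longrightarrow> v \<notin> span Y \<Longrightarrow> general_position S (xs @ [v])"
      and Z: "Z \<subseteq> carrier V" "span Z \<noteq> carrier V"
        "\<And>v. v \<in> carrier V \<Longrightarrow> v \<notin> span Z \<Longrightarrow> general_position T (xs @ [v])"
      using general_position_snocE[OF S(1) fin(1) xs(2)] general_position_snocE[OF T(1) fin(2) xs(3)]
      by metis
    obtain v where "v \<in> carrier V" "v \<notin> span Y" "v \<notin> span Z"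
      using not_in_two_spansE[OF Y(1,2) Z(1,2)] .
    then show ?case using Y(3) Z(3) xs(1) by (intro exI[of _ "xs @ [v]"]) simp
  qed
  from this[of dim] obtain xs
    where xs: "length xs = dim" "general_position S xs" "general_position T xs" by auto
  then have indpt: "distinct xs" "set xs \<subseteq> carrier V" "lin_indpt (set xs)"
    by (auto simp: general_position_def lin_indpt_over_def)
  then have "basis (set xs)"
    using xs(1) by (intro dim_li_is_basis[OF fin_dim]) (auto simp: distinct_card)
  then show ?thesis using that indpt(1) xs by blast
qed

lemma (in vec_space) rank_mono:
  assumes A: "A \<in> carrier_mat n nc" and B: "B \<in> carrier_mat n m"
    and "col_space A \<subseteq> col_space B"
  shows "rank A \<le> rank B"
proof -
  have carrier: "set (cols A) \<subseteq> carrier_vec n" "set (cols B) \<subseteq> carrier_vec n"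
    using A B cols_dim by blast+
  have B_subspace: "VectorSpace.subspace class_ring (col_space B) V"
    unfolding col_space_def by (rule span_is_subspace) (use carrier in simp)
  moreover have "VectorSpace.subspace class_ring (col_space A) V"
    unfolding col_space_def by (rule span_is_subspace) (use carrier in simp)
  ultimately have "VectorSpace.subspace class_ring (col_space A) (vs (col_space B))"
    using nested_subspaces assms(3) by blast
  from vectorspace.subspace_dim[OF subspace_is_vs[OF B_subspace] this] show ?thesis
    using fin_dim_span_cols[OF A] fin_dim_span_cols[OF B] by (simp add: rank_def col_space_def)
qed

lemma (in vec_space) rank_mult_le:
  assumes A: "A \<in> carrier_mat n m" and B: "B \<in> carrier_mat m nc"
  shows "rank (A * B) \<le> rank A"
proof (rule rank_mono[OF _ A])
  show AB: "A * B \<in> carrier_mat n nc" using A B by simp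
  show "col_space (A * B) \<subseteq> col_space A"
    unfolding col_space_eq[OF AB] col_space_eq[OF A] using A B by fastforce
qed

lemma (in vec_space) rank_minus_le:
  assumes A: "A \<in> carrier_mat n nc" and B: "B \<in> carrier_mat n nc"
  shows "rank (A - B) \<le> rank A + rank B"
proof -
  have "- B = B * (- 1\<^sub>m nc)" using B by simp
  then have "A - B = A + B * (- 1\<^sub>m nc)" using A B by (simp add: minus_add_uminus_mat[OF A B])
  then have "rank (A - B) \<le> rank A + rank (B * (- 1\<^sub>m nc))"
    using rank_subadditive[OF A, of "B * (- 1\<^sub>m nc)"] B by simp
  also have "rank (B * (- 1\<^sub>m nc)) \<le> rank B" using B by (intro rank_mult_le) auto
  finally show ?thesis by simp
qed

lemma (in vec_space) rank_add_kernel_dim: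
  assumes A: "A \<in> carrier_mat n nc"
  shows "rank A + kernel_dim A = nc"
proof -
  interpret K: kernel n nc A using A by unfold_locales
  have "(\<lambda>v. A *\<^sub>v v) \<in> LinearCombinations.module_hom class_ring K.NC.V V"
    unfolding LinearCombinations.module_hom_def using A
    by (auto simp: module_vec_simps mult_add_distrib_mat_vec[OF A] mult_mat_vec[OF A])
  then interpret mult: linear_map class_ring K.NC.V V "\<lambda>v. A *\<^sub>v v"
    by unfold_locales
  have "mult.imT = col_space A"
    unfolding mult.im_def col_space_eq[OF A] using A by (auto simp: module_vec_simps)
  moreover have "mult.kerT = mat_kernel A"
    unfolding mult.ker_def mat_kernel[OF A] by (simp add: module_vec_simps)
  ultimately show ?thesis
    using mult.rank_nullity by (simp add: rank_def col_space_def K.NC.dim_is_n)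
qed

lemma (in vec_space) rank_mult_left_inverse:
  assumes "U \<in> carrier_mat n n" "W \<in> carrier_mat n n" "W * U = 1\<^sub>m n"
    and A: "A \<in> carrier_mat n nc"
  shows "rank (U * A) = rank A"
proof -
  have "kernel_dim (U * A) = kernel_dim A"
    unfolding kernel_dim_def using mat_kernel_mult_eq[OF A assms(1-3)] assms(1) A by simp
  moreover have "U * A \<in> carrier_mat n nc" using assms by simp
  ultimately show ?thesis using rank_add_kernel_dim[OF A] rank_add_kernel_dim[of "U * A" nc] by simp
qed

lemma pow_mat_Suc_left:
  fixes A :: "'a :: semiring_1 mat"
  assumes A: "A \<in> carrier_mat n n"
  shows "A ^\<^sub>m Suc k = A * A ^\<^sub>m k"
proof -
  interpret semiring "ring_mat TYPE('a) n ()" by (rule semiring_mat)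
  show ?thesis
    using nat_pow_Suc2[of A k] A by (simp only: pow_mat_ring_pow[OF A, of _ "()"] ring_mat_simps)
qed

lemma pow_mat_pow_mat:
  fixes A :: "'a :: semiring_1 mat"
  assumes A: "A \<in> carrier_mat n n"
  shows "(A ^\<^sub>m j) ^\<^sub>m k = A ^\<^sub>m (j * k)"
proof -
  interpret semiring "ring_mat TYPE('a) n ()" by (rule semiring_mat)
  have "A ^\<^sub>m j \<in> carrier_mat n n" using A by simp
  from pow_mat_ring_pow[OF this, of k "()"] show ?thesis
    using nat_pow_pow[of A j k] A by (simp only: pow_mat_ring_pow[OF A, of _ "()"] ring_mat_simps)
qed

lemma invertible_matE:
  assumes "invertible_mat U" "U \<in> carrier_mat n n"
  obtains W where "W \<in> carrier_mat n n" "U * W = 1\<^sub>m n" "W * U = 1\<^sub>m n"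
proof -
  obtain W where W: "U * W = 1\<^sub>m n" "W * U = 1\<^sub>m (dim_row W)"
    using assms unfolding invertible_mat_def inverts_mat_def by auto
  have "dim_col W = n" "dim_row W = n"
    using arg_cong[OF W(1), of dim_col] arg_cong[OF W(2), of dim_col] assms(2) by auto
  then show ?thesis using that[of W] W by auto
qed

lemma invertible_mat_if_det_nonzero:
  fixes U :: "'a :: field mat"
  assumes U: "U \<in> carrier_mat n n" and "det U \<noteq> 0"
  shows "invertible_mat U"
  using det_non_zero_imp_unit[OF assms, of "()"] U
  unfolding Units_def ring_mat_simps invertible_mat_def inverts_mat_def by auto

lemma (in vec_space) dim_le_mult_rank_add_rank_pow:
  assumes U: "U \<in> carrier_mat n n" "invertible_mat U" and N: "N \<in> carrier_mat n n"
  shows "n \<le> j * rank (U + N) + rank (N ^\<^sub>m j)"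
proof (induction j)
  case 0
  have "rank (1\<^sub>m n) = n" using det_rank_iff[of "1\<^sub>m n"] by simp
  then show ?case using N by simp
next
  case (Suc j)
  let ?A = "U + N"
  obtain W where W: "W \<in> carrier_mat n n" "W * U = 1\<^sub>m n" using invertible_matE[OF U(2,1)] by blast
  have Nj: "N ^\<^sub>m j \<in> carrier_mat n n" and A: "?A \<in> carrier_mat n n" using U N by simp_all
  have "?A * N ^\<^sub>m j = U * N ^\<^sub>m j + N ^\<^sub>m Suc j"
    using add_mult_distrib_mat[OF U(1) N Nj] pow_mat_Suc_left[OF N] by simp
  then have "U * N ^\<^sub>m j = ?A * N ^\<^sub>m j - N ^\<^sub>m Suc j" using U N Nj by (intro eq_matI) auto
  then have "rank (U * N ^\<^sub>m j) \<le> rank (?A * N ^\<^sub>m j) + rank (N ^\<^sub>m Suc j)"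
    using rank_minus_le[of "?A * N ^\<^sub>m j" n "N ^\<^sub>m Suc j"] A N Nj by simp
  moreover have "rank (?A * N ^\<^sub>m j) \<le> rank ?A" using A Nj by (rule rank_mult_le)
  moreover have "rank (U * N ^\<^sub>m j) = rank (N ^\<^sub>m j)"
    using rank_mult_left_inverse[OF U(1) W Nj] .
  ultimately show ?case using Suc.IH by simp
qed

lemma jordan_block_zero_pow_mult_vec:
  fixes x :: "'a :: field vec"
  assumes "x \<in> carrier_vec n" "i < n"
  shows "(jordan_block n 0 ^\<^sub>m r *\<^sub>v x) $ i = (if i + r < n then x $ (i + r) else 0)"
proof -
  have "(jordan_block n 0 ^\<^sub>m r *\<^sub>v x) $ i =
      (\<Sum>c\<in>{0..<n}. (jordan_block n 0 ^\<^sub>m r) $$ (i, c) * x $ c)"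
    using assms by (simp add: scalar_prod_def)
  also have "\<dots> = (\<Sum>c\<in>{0..<n}. if c = i + r then x $ c else 0)"
    using assms by (intro sum.cong) (auto simp: jordan_block_zero_pow)
  finally show ?thesis by simp
qed

lemma jordan_block_zero_pow_eq_zero:
  "n \<le> r \<Longrightarrow> jordan_block n (0 :: 'a :: field) ^\<^sub>m r = 0\<^sub>m n n"
  by (rule eq_matI) (auto simp: jordan_block_zero_pow)

lemma (in vec_space) mat_of_cols_mult_vec_in_span_take:
  assumes xs: "set xs \<subseteq> carrier_vec n" and y: "y \<in> carrier_vec (length xs)"
    and zero: "\<And>i. m \<le> i \<Longrightarrow> i < length xs \<Longrightarrow> y $ i = 0"
  shows "mat_of_cols n xs *\<^sub>v y \<in> span (set (take m xs))"
proof -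
  have carrier: "set (take m xs) \<subseteq> carrier_vec n" using xs by (meson order_trans set_take_subset)
  have in_span: "y $ i \<cdot>\<^sub>v xs ! i \<in> span (set (take m xs))" if i: "i < length xs" for i
  proof (rule prod_in_span[OF _ carrier])
    show "xs ! i \<in> carrier_vec n" using i xs by auto
    show "y $ i = 0 \<or> xs ! i \<in> span (set (take m xs))"
      using i zero[of i] span_mem[OF carrier] by (force simp: in_set_conv_nth)
  qed
  have "mat_of_cols n xs *\<^sub>v y = lincomb_list (\<lambda>i. y $ i) xs"
  proof -
    have "vec (length xs) (\<lambda>i. y $ i) = y" using y by auto
    then show ?thesis using lincomb_list_as_mat_mult[of xs "\<lambda>i. y $ i"] xs by fastforce
  qed
  also have "\<dots> \<in> span (set (take m xs))"
    unfolding lincomb_list_def by (intro sumlist_in_span[OF carrier]) (clarsimp simp: in_span)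
  finally show ?thesis .
qed

lemma (in vec_space) invertible_mat_mat_of_cols_basis:
  assumes "basis (set xs)" "distinct xs"
  shows "invertible_mat (mat_of_cols n xs)"
proof -
  have xs: "set xs \<subseteq> carrier_vec n" "lin_indpt (set xs)" using assms(1) by (auto simp: basis_def)
  have "length xs = n" using dim_basis[OF _ assms(1)] assms(2) by (simp add: dim_is_n distinct_card)
  then have P: "mat_of_cols n xs \<in> carrier_mat n n" by auto
  have "cols (mat_of_cols n xs) = xs" using xs by simp
  then have "rank (mat_of_cols n xs) = n" using lin_indpt_full_rank[OF P] xs assms(2) by simp
  then show ?thesis using det_rank_iff[OF P] invertible_mat_if_det_nonzero[OF P] by simp
qed

lemma (in vec_space) col_space_basisE:
  assumes A: "A \<in> carrier_mat n nc"
  obtains S where "S \<subseteq> carrier_vec n" "lin_indpt S" "span S = col_space A" "card S = rank A"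
proof -
  have cols: "set (cols A) \<subseteq> carrier_vec n" using A cols_dim by blast
  have submodule: "submodule class_ring (col_space A) V"
    unfolding col_space_def using cols by (intro span_is_submodule) simp
  interpret C: vectorspace class_ring "vs (col_space A)"
    by (rule subspace_is_vs) (simp add: VectorSpace.subspace_def submodule vec_vs)
  obtain S where S: "finite S" "C.basis S"
    using C.finite_basis_exists fin_dim_span_cols[OF A] by (auto simp: col_space_def)
  then have "S \<subseteq> col_space A" by (simp add: C.basis_def)
  show ?thesis
  proof
    show "S \<subseteq> carrier_vec n"
      using \<open>S \<subseteq> col_space A\<close> cols span_is_subset2[of "set (cols A)"] by (auto simp: col_space_def)
    show "lin_indpt S" "span S = col_space A"
      using S(2) span_li_not_depend[OF \<open>S \<subseteq> col_space A\<close> submodule] by (auto simp: C.basis_def)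
    show "card S = rank A" using C.dim_basis[OF S] by (simp add: rank_def col_space_def)
  qed
qed

lemma (in vec_space) mat_kernel_basisE:
  assumes A: "A \<in> carrier_mat nr n"
  obtains S where "S \<subseteq> carrier_vec n" "lin_indpt S" "span S = mat_kernel A" "card S = kernel_dim A"
proof -
  interpret K: kernel nr n A using A by unfold_locales
  obtain S where S: "finite S" "K.basis S" using kernel_basis_exists[OF A] by blast
  then have "S \<subseteq> mat_kernel A" by (simp add: K.Ker.basis_def)
  show ?thesis
  proof
    show "S \<subseteq> carrier_vec n" using \<open>S \<subseteq> mat_kernel A\<close> mat_kernel_carrier[OF A] by blast
    show "lin_indpt S" using S(2) K.lindep_same[OF \<open>S \<subseteq> mat_kernel A\<close>] by (simp add: K.Ker.basis_def)
    show "span S = mat_kernel A"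
      using S(2) K.span_same[OF \<open>S \<subseteq> mat_kernel A\<close>] by (simp add: K.Ker.basis_def)
    show "card S = kernel_dim A" using K.Ker.dim_basis[OF S] by simp
  qed
qed

lemma (in vec_space) invertible_mat_minus_if_trivial_Int:
  assumes A: "A \<in> carrier_mat n n" and N: "N \<in> carrier_mat n n"
    and col_space: "col_space A \<inter> col_space N \<subseteq> {0\<^sub>v n}"
    and mat_kernel: "mat_kernel A \<inter> mat_kernel N \<subseteq> {0\<^sub>v n}"
  shows "invertible_mat (A - N)"
proof -
  have U: "A - N \<in> carrier_mat n n" using N by (rule minus_carrier_mat)
  have "x = 0\<^sub>v n" if x: "x \<in> carrier_vec n" "(A - N) *\<^sub>v x = 0\<^sub>v n" for x
  proof -
    have "A = (A - N) + N" using A N by (intro eq_matI) simp_all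
    then have Ax_eq_Nx: "A *\<^sub>v x = N *\<^sub>v x"
      using add_mult_distrib_mat_vec[OF U N x(1)] x N by simp
    have "A *\<^sub>v x \<in> col_space A" "N *\<^sub>v x \<in> col_space N"
      using A N x(1) by (auto simp: col_space_eq[OF A] col_space_eq[OF N])
    then have "A *\<^sub>v x = 0\<^sub>v n" using Ax_eq_Nx col_space by auto
    then have "x \<in> mat_kernel A \<inter> mat_kernel N"
      using Ax_eq_Nx mat_kernelI[OF A x(1)] mat_kernelI[OF N x(1)] by simp
    then show ?thesis using mat_kernel by blast
  qed
  then have "det (A - N) \<noteq> 0" using det_0_iff_vec_prod_zero_field[OF U] by blast
  then show ?thesis by (rule invertible_mat_if_det_nonzero[OF U])
qed

lemma (in vec_space) col_space_jordan_block_conj_subset: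
  assumes xs: "set xs \<subseteq> carrier_vec n" "length xs = n" and Q: "Q \<in> carrier_mat n n"
  shows "col_space (mat_of_cols n xs * jordan_block n 0 ^\<^sub>m r * Q) \<subseteq> span (set (take (n - r) xs))"
proof
  let ?P = "mat_of_cols n xs" and ?J = "jordan_block n (0 :: 'a) ^\<^sub>m r"
  have P: "?P \<in> carrier_mat n n" and J: "?J \<in> carrier_mat n n" using xs(2) by auto
  have PJ: "?P * ?J \<in> carrier_mat n n" using P J by (rule mult_carrier_mat)
  have N: "?P * ?J * Q \<in> carrier_mat n n" using PJ Q by (rule mult_carrier_mat)
  fix v assume "v \<in> col_space (?P * ?J * Q)"
  then obtain x where x: "x \<in> carrier_vec n" and v: "v = (?P * ?J * Q) *\<^sub>v x"
    using Q by (auto simp: col_space_eq[OF N])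
  have Qx: "Q *\<^sub>v x \<in> carrier_vec n" using Q x by simp
  have JQx: "?J *\<^sub>v (Q *\<^sub>v x) \<in> carrier_vec n" using J Qx by (rule mult_mat_vec_carrier)
  have "v = ?P *\<^sub>v (?J *\<^sub>v (Q *\<^sub>v x))"
    unfolding v assoc_mult_mat_vec[OF PJ Q x] by (rule assoc_mult_mat_vec[OF P J Qx])
  also have "\<dots> \<in> span (set (take (n - r) xs))"
    using xs JQx
    by (intro mat_of_cols_mult_vec_in_span_take)
      (simp_all add: jordan_block_zero_pow_mult_vec[OF Qx] del: index_mult_mat_vec)
  finally show "v \<in> span (set (take (n - r) xs))" .
qed

lemma (in vec_space) mat_kernel_jordan_block_conj_subset:
  assumes xs: "set xs \<subseteq> carrier_vec n" "length xs = n"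
    and Q: "Q \<in> carrier_mat n n" "mat_of_cols n xs * Q = 1\<^sub>m n"
  shows "mat_kernel (mat_of_cols n xs * jordan_block n 0 ^\<^sub>m r * Q) \<subseteq> span (set (take r xs))"
proof
  let ?P = "mat_of_cols n xs" and ?J = "jordan_block n (0 :: 'a) ^\<^sub>m r"
  have P: "?P \<in> carrier_mat n n" and J: "?J \<in> carrier_mat n n" using xs(2) by auto
  have JQ: "?J * Q \<in> carrier_mat n n" using J Q(1) by (rule mult_carrier_mat)
  have QP: "Q * ?P = 1\<^sub>m n" by (rule mat_mult_left_right_inverse[OF P Q])
  fix x assume "x \<in> mat_kernel (?P * ?J * Q)"
  then have "x \<in> mat_kernel (?J * Q)"
    using mat_kernel_mult_eq[OF JQ P Q(1) QP] assoc_mult_mat[OF P J Q(1)] by simp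
  then have x: "x \<in> carrier_vec n" and "(?J * Q) *\<^sub>v x = 0\<^sub>v n"
    using mat_kernelD[OF JQ] by blast+
  then have JQx: "?J *\<^sub>v (Q *\<^sub>v x) = 0\<^sub>v n" using assoc_mult_mat_vec[OF J Q(1)] by simp
  have Qx: "Q *\<^sub>v x \<in> carrier_vec n" using Q x by simp
  have "(Q *\<^sub>v x) $ i = 0" if "r \<le> i" "i < n" for i
    using jordan_block_zero_pow_mult_vec[OF Qx, of "i - r" r] JQx that by simp
  then have "?P *\<^sub>v (Q *\<^sub>v x) \<in> span (set (take r xs))"
    using xs Qx by (intro mat_of_cols_mult_vec_in_span_take) simp_all
  moreover have "?P *\<^sub>v (Q *\<^sub>v x) = x"
    using assoc_mult_mat_vec[OF P Q(1) x] Q(2) x by simp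
  ultimately show "x \<in> span (set (take r xs))" by simp
qed

lemma jordan_block_conj_pow_eq_zero:
  fixes P Q :: "'a :: field mat"
  assumes P: "P \<in> carrier_mat n n" and Q: "Q \<in> carrier_mat n n" "P * Q = 1\<^sub>m n"
    and "n \<le> r * k"
  shows "(P * jordan_block n 0 ^\<^sub>m r * Q) ^\<^sub>m k = 0\<^sub>m n n"
proof -
  let ?J = "jordan_block n (0 :: 'a) ^\<^sub>m r"
  have "similar_mat_wit (P * ?J * Q) ?J P Q"
    using P Q mat_mult_left_right_inverse[OF P Q] by (intro similar_mat_witI) auto
  then have "(P * ?J * Q) ^\<^sub>m k = P * ?J ^\<^sub>m k * Q" by (rule similar_mat_wit_pow_id)
  also have "?J ^\<^sub>m k = 0\<^sub>m n n"
    using assms(4) by (simp add: pow_mat_pow_mat[of _ n] jordan_block_zero_pow_eq_zero)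
  finally show ?thesis using P Q by simp
qed

lemma (in vec_space) invertible_plus_nilpotent_if_rank_ge:
  assumes A: "A \<in> carrier_mat n n" and bound: "n \<le> k * rank A"
  obtains U N where "U \<in> carrier_mat n n" "invertible_mat U"
    "N \<in> carrier_mat n n" "N ^\<^sub>m k = 0\<^sub>m n n" "A = U + N"
proof -
  define r where "r = rank A"
  obtain S where S: "S \<subseteq> carrier_vec n" "lin_indpt S" "span S = col_space A" "card S = r"
    using col_space_basisE[OF A] unfolding r_def .
  obtain T where T: "T \<subseteq> carrier_vec n" "lin_indpt T" "span T = mat_kernel A" "card T = kernel_dim A"
    using mat_kernel_basisE[OF A] .
  obtain xs where xs: "basis (set xs)" "distinct xs" "length xs = n"
    and position: "general_position S xs" "general_position T xs"
    using basis_in_general_position[OF fin_dim _ S(2) _ T(2)] S(1) T(1) by (auto simp: dim_is_n)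
  have carrier: "set xs \<subseteq> carrier_vec n" using xs(1) by (simp add: basis_def)
  have P: "mat_of_cols n xs \<in> carrier_mat n n" using xs(3) by auto
  obtain Q where Q: "Q \<in> carrier_mat n n" "mat_of_cols n xs * Q = 1\<^sub>m n"
    using invertible_matE[OF invertible_mat_mat_of_cols_basis[OF xs(1,2)] P] .
  define N where "N = mat_of_cols n xs * jordan_block n 0 ^\<^sub>m r * Q"
  have N: "N \<in> carrier_mat n n"
    unfolding N_def using P Q(1) by (intro mult_carrier_mat[of _ n n]) simp_all
  have "col_space A \<inter> span (set (take (n - r) xs)) = {0\<^sub>v n}"
    using general_position_span_Int[OF _ position(1)] S by (simp add: dim_is_n)
  then have "col_space A \<inter> col_space N \<subseteq> {0\<^sub>v n}"
    using col_space_jordan_block_conj_subset[OF carrier xs(3) Q(1)] unfolding N_def by blast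
  moreover have "n - card T = r" using rank_add_kernel_dim[OF A] T(4) by (simp add: r_def)
  then have "mat_kernel A \<inter> span (set (take r xs)) = {0\<^sub>v n}"
    using general_position_span_Int[OF _ position(2)] T by (simp add: dim_is_n)
  then have "mat_kernel A \<inter> mat_kernel N \<subseteq> {0\<^sub>v n}"
    using mat_kernel_jordan_block_conj_subset[OF carrier xs(3) Q] unfolding N_def by blast
  ultimately have "invertible_mat (A - N)" by (rule invertible_mat_minus_if_trivial_Int[OF A N])
  moreover have "N ^\<^sub>m k = 0\<^sub>m n n"
    unfolding N_def using bound
    by (intro jordan_block_conj_pow_eq_zero[OF P Q]) (simp add: r_def mult.commute)
  moreover have "A - N \<in> carrier_mat n n" using N by (rule minus_carrier_mat)
  moreover have "A = (A - N) + N" using A N by auto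
  ultimately show ?thesis using that N by blast
qed

theorem theorem2p7:
  fixes A :: "'a :: field mat" and n k :: nat
  assumes "n \<ge> 2" and "k \<ge> 1"
    and "A \<in> carrier_mat n n" and "A \<noteq> 0\<^sub>m n n"
  shows "(\<exists>U \<in> carrier_mat n n. \<exists>N \<in> carrier_mat n n.
            invertible_mat U \<and> nilpotent_mat N \<and> N ^\<^sub>m k = 0\<^sub>m n n \<and> A = U + N)
         \<longleftrightarrow> (of_nat (vec_space.rank n A) :: rat) \<ge> of_nat n / of_nat k"
  (is "?decomposes \<longleftrightarrow> ?bound")
proof -
  interpret vec_space "TYPE('a)" n .
  have "?bound \<longleftrightarrow> (of_nat n :: rat) \<le> of_nat (k * rank A)"
    using assms(2) by (simp add: divide_le_eq mult.commute)
  also have "\<dots> \<longleftrightarrow> n \<le> k * rank A" by (rule of_nat_le_iff)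
  also have "\<dots> \<longleftrightarrow> ?decomposes"
  proof
    assume "n \<le> k * rank A"
    from invertible_plus_nilpotent_if_rank_ge[OF assms(3) this] obtain U N
      where "U \<in> carrier_mat n n" "invertible_mat U"
        "N \<in> carrier_mat n n" "N ^\<^sub>m k = 0\<^sub>m n n" "A = U + N" .
    then show ?decomposes using assms(2) by (auto simp: nilpotent_mat_def)
  next
    assume ?decomposes
    then obtain U N where "U \<in> carrier_mat n n" "invertible_mat U" "N \<in> carrier_mat n n"
      and N: "N ^\<^sub>m k = 0\<^sub>m n n" and A: "A = U + N" by blast
    then have "n \<le> k * rank A + rank (N ^\<^sub>m k)"
      using dim_le_mult_rank_add_rank_pow by blast
    then show "n \<le> k * rank A" by (simp add: N rank_0I)
  qed
  finally show ?thesis by blast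
qed

end
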